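(* Let $H = (V,E)$ be a hypertree such that for each edge $e \in E$, with $m = |e|$, there is a choice of subset $S(\pi) \subseteq [m-1]$ for each bijection $\pi: e \to [m]$ such that the set of nonconstant colorings $\chi: e \to \mathbb{P}$ is the disjoint union $$\biguplus_{\pi} A(\pi, S(\pi))$$ over all bijections $\pi: e \to [m]$. Then $X_H$ is $F$-positive.
   Context: $\mathbb{P}=\{1,2,\ldots\}$. For a finite set $e$ with $|e|=m$, a bijection $\pi: e \to [m]$ and $S \subseteq [m-1]$, $A(\pi,S)$ is the set of maps $\chi: e \to \mathbb{P}$ with $\chi(\pi^{-1}(1)) \le \cdots \le \chi(\pi^{-1}(m))$ and $\chi(\pi^{-1}(i)) < \chi(\pi^{-1}(i+1))$ for $i \in S$. A hypergraph is a pair $H=(V,E)$ with $V$ finite and $E$ a family of subsets of $V$ with $|e|>1$. A path is a sequence $v_1, e_1, v_2, \ldots, e_m, v_{m+1}$ with $e_i \in E$, $v_i, v_{i+1} \in e_i$, edges distinct and vertices distinct except that $v_1 = v_{m+1}$ is allowed; if $v_1 = v_{m+1}$ and $m>1$ it is a cycle. A hypertree is a connected hypergraph with no cycles. A coloring of $V$ is proper if it is nonconstant on every edge; $X_H = \sum_\chi \prod_{v\in V} x_{\chi(v)}$ over proper colorings. With $n=|V|$, $F_S = \sum x_{i_1}\cdots x_{i_n}$ over $i_1 \le \cdots \le i_n$ in $\mathbb{P}$ with $i_j < i_{j+1}$ for $j \in S$; $X_H$ is $F$-positive if all coefficients of its expansion in the $F_S$, $S \subseteq [n-1]$, are nonnegative.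 *)

theory Defs
  imports "HOL-Library.FuncSet"
begin

text \<open>Positive integers P are represented as naturals \<open>\<ge> 1\<close>. A map
  from a finite set X to P is a function \<open>'a \<Rightarrow> nat\<close> that is extensional on X
  (value undefined outside X) and takes values \<open>\<ge> 1\<close> on X.\<close>

definition pos_maps :: "'a set \<Rightarrow> ('a \<Rightarrow> nat) set" where
  "pos_maps X = {\<chi> \<in> extensional X. \<forall>v\<in>X. 1 \<le> \<chi> v}"

definition bijs :: "'a set \<Rightarrow> ('a \<Rightarrow> nat) set" where
  "bijs e = {\<pi> \<in> extensional e. bij_betw \<pi> e {1..card e}}"

definition A_set :: "'a set \<Rightarrow> ('a \<Rightarrow> nat) \<Rightarrow> nat set \<Rightarrow> ('a \<Rightarrow> nat) set" where
  "A_set e \<pi> S = {\<chi> \<in> pos_maps e.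
      (\<forall>i\<in>{1..<card e}. \<chi> (inv_into e \<pi> i) \<le> \<chi> (inv_into e \<pi> (i + 1))) \<and>
      (\<forall>i\<in>S. \<chi> (inv_into e \<pi> i) < \<chi> (inv_into e \<pi> (i + 1)))}"

definition nonconst_colorings :: "'a set \<Rightarrow> ('a \<Rightarrow> nat) set" where
  "nonconst_colorings e = {\<chi> \<in> pos_maps e. \<exists>u\<in>e. \<exists>v\<in>e. \<chi> u \<noteq> \<chi> v}"

definition hypergraph :: "'a set \<Rightarrow> 'a set set \<Rightarrow> bool" where
  "hypergraph V E \<longleftrightarrow> finite V \<and> (\<forall>e\<in>E. e \<subseteq> V \<and> card e > 1)"

text \<open>A path v_1, e_1, ..., e_m, v_{m+1}: vertex list vs of length m+1, edge list es of
  length m; edges distinct; vertices distinct except that v_1 = v_{m+1} is allowed.\<close>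
definition is_path :: "'a set set \<Rightarrow> 'a list \<Rightarrow> 'a set list \<Rightarrow> bool" where
  "is_path E vs es \<longleftrightarrow> length vs = length es + 1 \<and> set es \<subseteq> E \<and> distinct es \<and>
     (\<forall>i < length es. vs ! i \<in> es ! i \<and> vs ! (i + 1) \<in> es ! i) \<and>
     distinct (butlast vs) \<and> distinct (tl vs)"

definition is_cycle :: "'a set set \<Rightarrow> 'a list \<Rightarrow> 'a set list \<Rightarrow> bool" where
  "is_cycle E vs es \<longleftrightarrow> is_path E vs es \<and> hd vs = last vs \<and> length es > 1"

definition connected_hg :: "'a set \<Rightarrow> 'a set set \<Rightarrow> bool" where
  "connected_hg V E \<longleftrightarrow> (\<forall>u\<in>V. \<forall>v\<in>V. \<exists>vs es. is_path E vs es \<and> hd vs = u \<and> last vs = v)"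

definition hypertree :: "'a set \<Rightarrow> 'a set set \<Rightarrow> bool" where
  "hypertree V E \<longleftrightarrow> hypergraph V E \<and> connected_hg V E \<and> (\<nexists>vs es. is_cycle E vs es)"

definition proper :: "'a set set \<Rightarrow> ('a \<Rightarrow> nat) \<Rightarrow> bool" where
  "proper E \<chi> \<longleftrightarrow> (\<forall>e\<in>E. \<exists>u\<in>e. \<exists>v\<in>e. \<chi> u \<noteq> \<chi> v)"

text \<open>Monomials in x_1, x_2, ... are exponent vectors \<open>\<alpha> :: nat \<Rightarrow> nat\<close>
  (\<alpha> i = exponent of x_i). Formal power series are identified with their coefficient
  functions. Coefficient of \<alpha> in X_H:\<close>
definition XH_coeff :: "'a set \<Rightarrow> 'a set set \<Rightarrow> (nat \<Rightarrow> nat) \<Rightarrow> nat" where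
  "XH_coeff V E \<alpha> = card {\<chi> \<in> pos_maps V. proper E \<chi> \<and>
       (\<lambda>i. card {v\<in>V. \<chi> v = i}) = \<alpha>}"

definition F_coeff :: "nat \<Rightarrow> nat set \<Rightarrow> (nat \<Rightarrow> nat) \<Rightarrow> nat" where
  "F_coeff n S \<alpha> = card {i \<in> pos_maps {1..n}.
       (\<forall>j\<in>{1..<n}. i j \<le> i (j + 1)) \<and> (\<forall>j\<in>S. i j < i (j + 1)) \<and>
       (\<lambda>k. card {j\<in>{1..n}. i j = k}) = \<alpha>}"

definition F_positive :: "'a set \<Rightarrow> 'a set set \<Rightarrow> bool" where
  "F_positive V E \<longleftrightarrow> (\<exists>c :: nat set \<Rightarrow> int.
      (\<forall>S. S \<subseteq> {1..<card V} \<longrightarrow> 0 \<le> c S) \<and>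
      (\<forall>\<alpha>. int (XH_coeff V E \<alpha>) =
             (\<Sum>S\<in>Pow {1..<card V}. c S * int (F_coeff (card V) S \<alpha>))))"

end

theory Submission
  imports Defs
begin

text \<open>
  Choosing one bijection per edge splits the proper colorings into disjoint classes, each
  cut out by weak and strict inequalities along a chain on every edge. Each chain, with its
  strict steps, prescribes a linear order on its edge for which exactly the strict steps are
  descents. As the hypergraph has no cycles, a shortest closed walk along these orders cannot
  exist, so they extend to one labelling of all vertices. The class is then a set of
  \<open>(P, \<omega>)\<close>-partitions, and sorting the vertices by color, with ties broken by the
  labelling, writes it as a disjoint union of sets \<open>A(\<sigma>, Des \<sigma>)\<close>, each contributing one
  fundamental quasisymmetric function.
\<close>

section \<open>Linear orders on the edges of an acyclic hypergraph\<close>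

text \<open>A shortest closed walk through the edge orders would be a cycle of the hypergraph: a
  repeated vertex or a repeated edge would let it be shortened.\<close>

lemma acyclic_Union_edge_orders:
  fixes g :: "'a set \<Rightarrow> 'a \<Rightarrow> 'b::linorder"
  assumes inj: "\<And>e. e \<in> E \<Longrightarrow> inj_on (g e) e"
    and no_cycle: "\<nexists>vs es. is_cycle E vs es"
  shows "acyclic (\<Union>e\<in>E. {(a, b). a \<in> e \<and> b \<in> e \<and> g e a < g e b})"
proof (rule ccontr)
  define r where "r = (\<lambda>e. {(a, b). a \<in> e \<and> b \<in> e \<and> g e a < g e b})"
  \<comment> \<open>The edge used by each step is recorded because a cycle consists of vertices and
    edges. Only indices up to \<open>m\<close> matter, so a stretch of a walk is cut out by shifting
    indices.\<close>
  define walk where "walk = (\<lambda>m (v :: nat \<Rightarrow> 'a) e.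
    0 < m \<and> v 0 = v m \<and> (\<forall>i<m. e i \<in> E \<and> (v i, v (Suc i)) \<in> r (e i)))"
  assume "\<not> ?thesis"
  then obtain x where "(x, x) \<in> (\<Union>e\<in>E. r e)\<^sup>+"
    unfolding acyclic_def r_def by blast
  then obtain n where n: "n > 0" "(x, x) \<in> (\<Union>e\<in>E. r e) ^^ n"
    using trancl_power by blast
  then obtain v0 where v0: "v0 0 = x" "v0 n = x"
      "\<forall>i<n. (v0 i, v0 (Suc i)) \<in> (\<Union>e\<in>E. r e)"
    unfolding relpow_fun_conv by blast
  have "\<forall>i. \<exists>e. i < n \<longrightarrow> e \<in> E \<and> (v0 i, v0 (Suc i)) \<in> r e"
    using v0(3) by blast
  then obtain e0 where "\<forall>i<n. e0 i \<in> E \<and> (v0 i, v0 (Suc i)) \<in> r (e0 i)"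
    by metis
  then have ex: "\<exists>m v e. walk m v e"
    unfolding walk_def using n v0 by metis
  define m where "m = (LEAST m. \<exists>v e. walk m v e)"
  obtain v e where w: "walk m v e"
    using LeastI_ex[OF ex] unfolding m_def by blast
  have minimal: "m \<le> k" if "walk k v' e'" for k v' e'
    unfolding m_def using that by (intro Least_le) blast
  from w have m0: "0 < m" and closed: "v 0 = v m"
    and eE: "\<And>i. i < m \<Longrightarrow> e i \<in> E"
    and step: "\<And>i. i < m \<Longrightarrow> (v i, v (Suc i)) \<in> r (e i)"
    unfolding walk_def by auto
  \<comment> \<open>The stretch from \<open>i\<close> to \<open>j\<close> would itself be a closed
    walk, of length \<open>j - i < m\<close>.\<close>
  have v_neq: "v i \<noteq> v j" if "i < j" "j < m" for i j
  proof
    assume "v i = v j"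
    then have "walk (j - i) (\<lambda>k. v (i + k)) (\<lambda>k. e (i + k))"
      unfolding walk_def using that eE step by auto
    then show False using minimal that by fastforce
  qed
  have e_neq: "e i \<noteq> e j" if ij: "i < j" "j < m" for i j
  proof
    assume eq: "e i = e j"
    have mem: "v i \<in> e i" "v (Suc i) \<in> e i" "v j \<in> e i" "v (Suc j) \<in> e i"
      and less: "g (e i) (v i) < g (e i) (v (Suc i))" "g (e i) (v j) < g (e i) (v (Suc j))"
      using step[of i] step[of j] ij eq unfolding r_def by auto
    show False
    \<comment> \<open>Both steps lie in the order of one edge. If \<open>v i\<close> precedes
      \<open>v (Suc j)\<close> there, a single step of this edge bypasses everything in between.
      Otherwise \<open>v j\<close> < \<open>v (Suc j)\<close> \<le> \<open>v i\<close> <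
      \<open>v (Suc i)\<close> in terms of \<open>g (e i)\<close>, and a step from
      \<open>v j\<close> back to \<open>v (Suc i)\<close> closes up the stretch between them. Both
      walks are shorter than \<open>m\<close>.\<close>
    proof (cases "g (e i) (v i) < g (e i) (v (Suc j))")
      case True
      define v' where "v' = (\<lambda>k. if k \<le> i then v k else v (k + (j - i)))"
      define e' where "e' = (\<lambda>k. if k \<le> i then e k else e (k + (j - i)))"
      have "e' k \<in> E \<and> (v' k, v' (Suc k)) \<in> r (e' k)" if k: "k < m - (j - i)" for k
      proof -
        consider "k < i" | "k = i" | "i < k" by linarith
        then show ?thesis
        proof cases
          case 1
          then show ?thesis using eE step ij by (auto simp: v'_def e'_def)
        next
          case 2
          have "(v i, v (Suc j)) \<in> r (e i)" using True mem by (auto simp: r_def)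
          then show ?thesis using 2 eE ij by (auto simp: v'_def e'_def)
        next
          case 3
          then have "v' k = v (k + (j - i))" "v' (Suc k) = v (Suc (k + (j - i)))"
              "e' k = e (k + (j - i))"
            by (simp_all add: v'_def e'_def)
          moreover have "k + (j - i) < m" using k by linarith
          ultimately show ?thesis using eE step by metis
        qed
      qed
      then have "walk (m - (j - i)) v' e'"
        unfolding walk_def using ij closed by (auto simp: v'_def)
      then have "m \<le> m - (j - i)" by (rule minimal)
      then show False using ij by linarith
    next
      case False
      define v' where "v' = (\<lambda>k. if k < j - i then v (Suc i + k) else v (Suc i))"
      have last: "(v j, v (Suc i)) \<in> r (e j)"
        using False less mem eq by (auto simp: r_def)
      have "e (Suc i + k) \<in> E \<and> (v' k, v' (Suc k)) \<in> r (e (Suc i + k))"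
        if k: "k < j - i" for k
      proof (cases "Suc k = j - i")
        case True
        then have "Suc i + k = j" using ij by linarith
        then show ?thesis using last eE ij k True by (auto simp: v'_def)
      next
        case False
        then show ?thesis using eE step ij k by (auto simp: v'_def)
      qed
      then have "walk (j - i) v' (\<lambda>k. e (Suc i + k))"
        unfolding walk_def using ij by (auto simp: v'_def)
      then have "m \<le> j - i" by (rule minimal)
      then show False using ij by linarith
    qed
  qed
  \<comment> \<open>A closed walk of one step would make a value of \<open>g (e 0)\<close> smaller
    than itself.\<close>
  have "m \<noteq> 1"
    using step[of 0] closed by (auto simp: r_def)
  then have m1: "m > 1" using m0 by linarith
  define vs where "vs = map v [0..<Suc m]"
  define es where "es = map e [0..<m]"
  have inj_v: "inj_on v {0..<m}"
    by (rule inj_onI, rule ccontr) (metis v_neq atLeastLessThan_iff linorder_neqE_nat)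
  have inj_v': "inj_on v {1..<Suc m}"
  proof -
    \<comment> \<open>For \<open>j = m\<close> the comparison is moved to index 0, as
      \<open>v m = v 0\<close> and \<open>1 \<le> i\<close>.\<close>
    have "v i \<noteq> v j" if "i < j" "1 \<le> i" "j \<le> m" for i j
      using that v_neq[of i j] v_neq[of 0 i] closed by (cases "j = m") auto
    then show ?thesis
      by (intro inj_onI, metis atLeastLessThan_iff less_Suc_eq_le linorder_neqE_nat)
  qed
  have inj_e: "inj_on e {0..<m}"
    by (rule inj_onI, rule ccontr) (metis e_neq atLeastLessThan_iff linorder_neqE_nat)
  have "butlast vs = map v [0..<m]"
    by (simp add: vs_def)
  then have "distinct (butlast vs)"
    using inj_v by (simp add: distinct_map)
  moreover have "tl vs = map v [1..<Suc m]"
    unfolding vs_def by (simp only: map_tl[symmetric] tl_upt One_nat_def)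
  then have "distinct (tl vs)"
    using inj_v' by (simp add: distinct_map del: upt_Suc)
  moreover have "vs ! i = v i" if "i \<le> m" for i
    using that unfolding vs_def by (metis add_0 diff_zero le_imp_less_Suc length_upt nth_map nth_upt)
  then have "\<forall>i<length es. vs ! i \<in> es ! i \<and> vs ! (i + 1) \<in> es ! i"
    using step by (auto simp: es_def r_def)
  moreover have "set es \<subseteq> E" "distinct es" "length es = m" "length vs = length es + 1"
    using eE inj_e by (auto simp: es_def vs_def distinct_map)
  moreover have "hd vs = v 0"
    unfolding vs_def by (simp add: hd_map del: upt_Suc)
  moreover have "last vs = v m"
    by (simp add: vs_def)
  ultimately have "is_cycle E vs es"
    unfolding is_cycle_def is_path_def using m1 closed by simp
  then show False using no_cycle by blast
qed

section \<open>One labelling for all edge orders\<close>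

text \<open>Induction on the set: an \<open>R\<close>-minimal element of \<open>V\<close> gets label
  0 and the labels of the others are shifted up by one.\<close>

lemma ex_inj_linear_extension:
  fixes V :: "'a set"
  assumes "finite V" "wf R"
  shows "\<exists>f :: 'a \<Rightarrow> nat. inj_on f V \<and> (\<forall>a\<in>V. \<forall>b\<in>V. (a, b) \<in> R \<longrightarrow> f a < f b)"
  using assms(1)
proof (induction V rule: finite_psubset_induct)
  case (psubset V)
  show ?case
  proof (cases "V = {}")
    case False
    then obtain x where x: "x \<in> V" "\<And>y. (y, x) \<in> R \<Longrightarrow> y \<notin> V"
      using wfE_min'[OF assms(2)] by metis
    then obtain f :: "'a \<Rightarrow> nat" where f: "inj_on f (V - {x})"
        "\<forall>a\<in>V - {x}. \<forall>b\<in>V - {x}. (a, b) \<in> R \<longrightarrow> f a < f b"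
      using psubset.IH[of "V - {x}"] by blast
    define h where "h = (\<lambda>v. if v = x then 0 else Suc (f v))"
    have "inj_on h V" using f(1) by (auto simp: h_def inj_on_def)
    moreover have "\<forall>a\<in>V. \<forall>b\<in>V. (a, b) \<in> R \<longrightarrow> h a < h b"
      using f(2) x by (auto simp: h_def)
    ultimately show ?thesis by blast
  qed simp
qed

lemma bijs_inv_into:
  assumes "\<pi> \<in> bijs e" "i \<in> {1..card e}"
  shows "inv_into e \<pi> i \<in> e" "\<pi> (inv_into e \<pi> i) = i"
  using assms by (auto simp: bijs_def bij_betw_def inv_into_into f_inv_into_f)

text \<open>Turns the strict steps prescribed on all edges into descents of a single labelling.
  Along \<open>p e\<close> the order \<open>g e\<close> has exactly these descents, the union of the
  edge orders is acyclic, and a linear extension preserves every inequality in it.\<close>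

lemma ex_labelling_with_descents:
  assumes hg: "hypergraph V E" and no_cycle: "\<nexists>vs es. is_cycle E vs es"
    and p: "\<And>e. e \<in> E \<Longrightarrow> p e \<in> bijs e"
  shows "\<exists>\<omega> :: 'a \<Rightarrow> nat. inj_on \<omega> V \<and>
    (\<forall>e\<in>E. \<forall>i\<in>{1..<card e}.
      if i \<in> T e then \<omega> (inv_into e (p e) (i + 1)) < \<omega> (inv_into e (p e) i)
      else \<omega> (inv_into e (p e) i) < \<omega> (inv_into e (p e) (i + 1)))"
proof -
  \<comment> \<open>Since \<open>\<bar>s e i\<bar> = i - 1\<close>, the sign of \<open>s e (i + 1)\<close> alone decides how it compares
    with all earlier values.\<close>
  define s :: "'a set \<Rightarrow> nat \<Rightarrow> int"
    where "s = (\<lambda>e i. if i - 1 \<in> T e then - int (i - 1) else int (i - 1))"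
  define g where "g = (\<lambda>e v. s e (p e v))"
  define R where "R = (\<Union>e\<in>E. {(a, b). a \<in> e \<and> b \<in> e \<and> g e a < g e b})"
  have "inj_on (g e) e" if "e \<in> E" for e
  proof -
    have "inj_on (s e) {1..card e}"
      by (auto simp: s_def inj_on_def split: if_splits)
    then have "inj_on (s e \<circ> p e) e"
      using p[OF that] by (intro comp_inj_on) (auto simp: bijs_def bij_betw_def)
    then show ?thesis by (simp add: g_def comp_def)
  qed
  then have "acyclic R"
    unfolding R_def using no_cycle by (rule acyclic_Union_edge_orders)
  moreover have fin: "finite V" and eV: "\<And>e. e \<in> E \<Longrightarrow> e \<subseteq> V"
    using hg by (auto simp: hypergraph_def)
  have "R \<subseteq> V \<times> V" using eV by (auto simp: R_def)
  then have "finite R" using fin by (meson finite_SigmaI finite_subset)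
  ultimately have "wf R" by (simp add: finite_acyclic_wf)
  then obtain \<omega> :: "'a \<Rightarrow> nat" where \<omega>: "inj_on \<omega> V"
      "\<And>a b. a \<in> V \<Longrightarrow> b \<in> V \<Longrightarrow> (a, b) \<in> R \<Longrightarrow> \<omega> a < \<omega> b"
    using ex_inj_linear_extension[OF fin] by metis
  have "if i \<in> T e then \<omega> (inv_into e (p e) (i + 1)) < \<omega> (inv_into e (p e) i)
      else \<omega> (inv_into e (p e) i) < \<omega> (inv_into e (p e) (i + 1))"
    if e: "e \<in> E" and i: "i \<in> {1..<card e}" for e i
  proof -
    let ?a = "inv_into e (p e) i" and ?b = "inv_into e (p e) (i + 1)"
    have ab: "?a \<in> e" "?b \<in> e" "p e ?a = i" "p e ?b = i + 1"
      using bijs_inv_into[OF p[OF e]] i by auto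
    have "if i \<in> T e then (?b, ?a) \<in> R else (?a, ?b) \<in> R"
    proof (cases "i \<in> T e")
      case True
      have "g e ?b < g e ?a" using True ab(3,4) i by (auto simp: g_def s_def)
      then show ?thesis using True e ab(1,2) by (auto simp: R_def)
    next
      case False
      have "g e ?a < g e ?b" using False ab(3,4) i by (auto simp: g_def s_def)
      then show ?thesis using False e ab(1,2) by (auto simp: R_def)
    qed
    then show ?thesis using \<omega>(2) ab(1,2) eV[OF e] by (auto split: if_splits)
  qed
  then show ?thesis using \<omega>(1) by blast
qed

section \<open>Sorting by an injective key\<close>

lemma bijs_eq_rank:
  assumes "finite V" "\<sigma> \<in> bijs V" "v \<in> V"
  shows "\<sigma> v = card {u \<in> V. \<sigma> u \<le> \<sigma> v}"
proof -
  have b: "bij_betw \<sigma> V {1..card V}" using assms by (simp add: bijs_def)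
  have "\<sigma> ` {u \<in> V. \<sigma> u \<le> \<sigma> v} = {1..\<sigma> v}"
  proof (intro equalityI subsetI)
    fix k assume k: "k \<in> {1..\<sigma> v}"
    then have "k \<in> \<sigma> ` V" using bij_betwE[OF b] assms(3) bij_betw_imp_surj_on[OF b] by force
    then show "k \<in> \<sigma> ` {u \<in> V. \<sigma> u \<le> \<sigma> v}" using k by auto
  qed (use bij_betwE[OF b] in auto)
  moreover have "inj_on \<sigma> {u \<in> V. \<sigma> u \<le> \<sigma> v}"
    using b by (auto simp: bij_betw_def inj_on_def)
  ultimately show ?thesis by (metis card_atLeastAtMost card_image diff_Suc_1)
qed

text \<open>By \<open>bijs_eq_rank\<close> each bijection is the rank function of the order it
  induces. This is what later makes the classes of colorings with different sorting orders
  disjoint.\<close>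

lemma bijs_eqI:
  assumes "finite V" "\<sigma> \<in> bijs V" "\<tau> \<in> bijs V"
    and "\<And>u v. u \<in> V \<Longrightarrow> v \<in> V \<Longrightarrow> \<sigma> u \<le> \<sigma> v \<longleftrightarrow> \<tau> u \<le> \<tau> v"
  shows "\<sigma> = \<tau>"
proof (rule extensionalityI[of _ V])
  fix v assume v: "v \<in> V"
  then have "{u \<in> V. \<sigma> u \<le> \<sigma> v} = {u \<in> V. \<tau> u \<le> \<tau> v}" using assms(4) by blast
  then show "\<sigma> v = \<tau> v" using bijs_eq_rank[OF assms(1,2) v] bijs_eq_rank[OF assms(1,3) v] by simp
qed (use assms in \<open>auto simp: bijs_def\<close>)

lemma ex_sorting_bij:
  fixes key :: "'a \<Rightarrow> nat"
  assumes "finite V" "inj_on key V"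
  shows "\<exists>\<sigma>\<in>bijs V. \<forall>u\<in>V. \<forall>v\<in>V. \<sigma> u < \<sigma> v \<longleftrightarrow> key u < key v"
proof -
  \<comment> \<open>The rank under \<open>key\<close>. Counting with \<le> includes \<open>v\<close>
    itself, so ranks start at 1; the restriction makes the map extensional, as \<open>bijs\<close>
    demands.\<close>
  define \<sigma> where "\<sigma> = (\<lambda>v\<in>V. card {u \<in> V. key u \<le> key v})"
  have less: "\<sigma> u < \<sigma> v" if "u \<in> V" "v \<in> V" "key u < key v" for u v
  proof -
    have "{w \<in> V. key w \<le> key u} \<subset> {w \<in> V. key w \<le> key v}"
      using that by force
    then show ?thesis using that assms(1) by (simp add: \<sigma>_def psubset_card_mono)
  qed
  have eq: "\<sigma> u < \<sigma> v \<longleftrightarrow> key u < key v" if "u \<in> V" "v \<in> V" for u v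
    using less[of u v] less[of v u] that assms(2)
    by (metis inj_onD less_asym less_irrefl linorder_neqE_nat)
  have inj: "inj_on \<sigma> V"
    using less assms(2) by (metis inj_on_def less_irrefl linorder_neqE_nat)
  have "\<sigma> v \<in> {1..card V}" if "v \<in> V" for v
  proof -
    have "card {v} \<le> \<sigma> v" unfolding \<sigma>_def using that assms(1)
      by (simp only: restrict_apply') (rule card_mono, auto)
    moreover have "\<sigma> v \<le> card V" using that assms(1) by (auto simp: \<sigma>_def intro: card_mono)
    ultimately show ?thesis by simp
  qed
  then have "\<sigma> ` V = {1..card V}"
    using inj by (intro card_subset_eq) (auto simp: card_image)
  then have "\<sigma> \<in> bijs V" using inj by (auto simp: bijs_def bij_betw_def \<sigma>_def)
  then show ?thesis using eq by blast
qed

text \<open>Connects agreement of two orders with the neighbour conditions in \<open>A_set\<close>.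
  Neighbours give all pairs by induction on the distance, and the converse implication for a pair
  follows because the order induced by \<sigma> is total.\<close>

lemma bijs_mono_iff_consecutive:
  fixes key :: "'a \<Rightarrow> nat"
  assumes "\<sigma> \<in> bijs V"
  shows "(\<forall>u\<in>V. \<forall>v\<in>V. \<sigma> u < \<sigma> v \<longleftrightarrow> key u < key v) \<longleftrightarrow>
    (\<forall>i\<in>{1..<card V}. key (inv_into V \<sigma> i) < key (inv_into V \<sigma> (i + 1)))"
    (is "?L \<longleftrightarrow> ?R")
proof
  assume ?L
  show ?R
  proof
    fix i assume "i \<in> {1..<card V}"
    then have "i \<in> {1..card V}" "i + 1 \<in> {1..card V}" by auto
    then show "key (inv_into V \<sigma> i) < key (inv_into V \<sigma> (i + 1))"
      using \<open>?L\<close> bijs_inv_into[OF assms] by (metis less_add_one)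
  qed
next
  assume R: ?R
  have less: "key (inv_into V \<sigma> i) < key (inv_into V \<sigma> j)"
    if "i < j" "1 \<le> i" "j \<le> card V" for i j
    using that
  proof (induction j rule: less_induct)
    case (less j)
    show ?case
    proof (cases "j = i + 1")
      case True
      then show ?thesis using R less.prems by auto
    next
      case False
      then have "key (inv_into V \<sigma> i) < key (inv_into V \<sigma> (j - 1))"
        using less.IH[of "j - 1"] less.prems by auto
      also have "\<dots> < key (inv_into V \<sigma> j)"
      proof -
        have "j - 1 \<in> {1..<card V}" "j - 1 + 1 = j" using less.prems by auto
        then show ?thesis using R by metis
      qed
      finally show ?thesis .
    qed
  qed
  have b: "bij_betw \<sigma> V {1..card V}" using assms by (simp add: bijs_def)
  have mono: "key u < key v" if "u \<in> V" "v \<in> V" "\<sigma> u < \<sigma> v" for u v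
    using less[OF that(3)] that bij_betwE[OF b] bij_betw_inv_into_left[OF b] by auto
  show ?L
  proof (intro ballI iffI mono)
    fix u v assume uv: "u \<in> V" "v \<in> V" "key u < key v"
    then have "\<sigma> u \<noteq> \<sigma> v" using b by (auto simp: bij_betw_def inj_on_def)
    then show "\<sigma> u < \<sigma> v" using mono[of v u] uv by force
  qed
qed

section \<open>F-positive sets of colorings\<close>

text \<open>Coefficients in the natural numbers build in nonnegativity. Allowing an arbitrary set
  \<open>C\<close> makes it possible to treat classes of proper colorings separately and add
  up.\<close>

definition F_expandable :: "'a set \<Rightarrow> ('a \<Rightarrow> nat) set \<Rightarrow> bool" where
  "F_expandable V C \<longleftrightarrow> (\<exists>c :: nat set \<Rightarrow> nat. \<forall>\<alpha>.
     card {\<chi> \<in> C. (\<lambda>i. card {v\<in>V. \<chi> v = i}) = \<alpha>} =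
       (\<Sum>S\<in>Pow {1..<card V}. c S * F_coeff (card V) S \<alpha>))"

text \<open>The content determines which colors occur, so all these colorings take values in the
  image of any one of them. Finiteness is what lets cardinalities of disjoint classes be
  added.\<close>

lemma finite_colorings_of_content:
  assumes "finite V" "C \<subseteq> pos_maps V"
  shows "finite {\<chi> \<in> C. (\<lambda>i. card {v\<in>V. \<chi> v = i}) = \<alpha>}" (is "finite ?M")
proof (cases "?M = {}")
  case False
  then obtain \<chi>0 where \<chi>0: "(\<lambda>i. card {v\<in>V. \<chi>0 v = i}) = \<alpha>" by blast
  have "\<chi> \<in> PiE V (\<lambda>_. \<chi>0 ` V)" if \<chi>: "\<chi> \<in> ?M" for \<chi>
  proof (rule PiE_I)
    fix v assume v: "v \<in> V"
    have "card {u\<in>V. \<chi>0 u = \<chi> v} = card {u\<in>V. \<chi> u = \<chi> v}"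
      using \<chi> \<chi>0 by (auto dest: fun_cong[of _ _ "\<chi> v"])
    also have "\<dots> \<noteq> 0" using v assms(1) by auto
    finally show "\<chi> v \<in> \<chi>0 ` V" by (metis (mono_tags, lifting) card.empty empty_Collect_eq imageI)
  next
    fix v assume "v \<notin> V"
    then show "\<chi> v = undefined"
      using \<chi> assms(2) by (auto simp: pos_maps_def extensional_def)
  qed
  then show ?thesis using assms(1)
    by (meson finite_PiE finite_imageI finite_subset subsetI)
qed (simp only: finite.emptyI)

text \<open>For each content the fibres of the classes are finite and disjoint, so their sizes add,
  and hence so do the coefficients.\<close>

lemma F_expandable_disjoint_UN:
  assumes fin: "finite V" "finite I" and sub: "\<And>i. i \<in> I \<Longrightarrow> C i \<subseteq> pos_maps V"
    and disj: "\<And>i j. i \<in> I \<Longrightarrow> j \<in> I \<Longrightarrow> i \<noteq> j \<Longrightarrow> C i \<inter> C j = {}"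
    and exp: "\<And>i. i \<in> I \<Longrightarrow> F_expandable V (C i)"
  shows "F_expandable V (\<Union>i\<in>I. C i)"
proof -
  let ?M = "\<lambda>C \<alpha>. {\<chi> \<in> C. (\<lambda>i. card {v\<in>V. \<chi> v = i}) = \<alpha>}"
  obtain c :: "_ \<Rightarrow> nat set \<Rightarrow> nat" where c: "\<And>i \<alpha>. i \<in> I \<Longrightarrow>
     card (?M (C i) \<alpha>) = (\<Sum>S\<in>Pow {1..<card V}. c i S * F_coeff (card V) S \<alpha>)"
  proof -
    have "\<forall>i\<in>I. \<exists>c :: nat set \<Rightarrow> nat. \<forall>\<alpha>.
        card (?M (C i) \<alpha>) = (\<Sum>S\<in>Pow {1..<card V}. c S * F_coeff (card V) S \<alpha>)"
      using exp unfolding F_expandable_def by (intro ballI)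
    from bchoice[OF this] obtain c :: "_ \<Rightarrow> nat set \<Rightarrow> nat" where
      "\<forall>i\<in>I. \<forall>\<alpha>. card (?M (C i) \<alpha>) =
        (\<Sum>S\<in>Pow {1..<card V}. c i S * F_coeff (card V) S \<alpha>)" by (elim exE)
    then show thesis by (intro that[of c]) simp
  qed
  have "card (?M (\<Union>i\<in>I. C i) \<alpha>) =
      (\<Sum>S\<in>Pow {1..<card V}. (\<Sum>i\<in>I. c i S) * F_coeff (card V) S \<alpha>)" for \<alpha>
  proof -
    have "?M (\<Union>i\<in>I. C i) \<alpha> = (\<Union>i\<in>I. ?M (C i) \<alpha>)" by blast
    also have "card \<dots> = (\<Sum>i\<in>I. card (?M (C i) \<alpha>))"
      using fin disj by (intro card_UN_disjoint ballI impI finite_colorings_of_content sub) blast+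
    also have "\<dots> = (\<Sum>i\<in>I. \<Sum>S\<in>Pow {1..<card V}. c i S * F_coeff (card V) S \<alpha>)"
      by (simp add: c)
    also have "\<dots> = (\<Sum>S\<in>Pow {1..<card V}. \<Sum>i\<in>I. c i S * F_coeff (card V) S \<alpha>)"
      by (rule sum.swap)
    finally show ?thesis by (simp add: sum_distrib_right)
  qed
  then show ?thesis
    unfolding F_expandable_def by (intro exI[of _ "\<lambda>S. \<Sum>i\<in>I. c i S"] allI)
qed

section \<open>One fundamental quasisymmetric function per bijection\<close>

text \<open>Listing the colors in the order given by \<sigma> turns a coloring into a sequence
  counted by \<open>F_coeff\<close>, with the same content. The inverse composes a sequence with
  \<sigma>.\<close>

lemma card_A_set_content:
  assumes \<sigma>: "\<sigma> \<in> bijs V" and S: "S \<subseteq> {1..<card V}"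
  shows "card {\<chi> \<in> A_set V \<sigma> S. (\<lambda>i. card {v\<in>V. \<chi> v = i}) = \<alpha>} = F_coeff (card V) S \<alpha>"
    (is "card ?X = _")
proof -
  let ?n = "card V"
  let ?Y = "{i \<in> pos_maps {1..?n}.
       (\<forall>j\<in>{1..<?n}. i j \<le> i (j + 1)) \<and> (\<forall>j\<in>S. i j < i (j + 1)) \<and>
       (\<lambda>k. card {j\<in>{1..?n}. i j = k}) = \<alpha>}"
  let ?inv = "inv_into V \<sigma>"
  define \<Phi> where "\<Phi> = (\<lambda>\<chi> :: 'a \<Rightarrow> nat. \<lambda>j\<in>{1..?n}. \<chi> (?inv j))"
  define \<Psi> where "\<Psi> = (\<lambda>i :: nat \<Rightarrow> nat. \<lambda>v\<in>V. i (\<sigma> v))"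
  have b: "bij_betw \<sigma> V {1..?n}" using \<sigma> by (simp add: bijs_def)
  note inv = bijs_inv_into[OF \<sigma>]
  have \<sigma>V: "\<sigma> v \<in> {1..?n}" "?inv (\<sigma> v) = v" if "v \<in> V" for v
    using that bij_betwE[OF b] bij_betw_inv_into_left[OF b] by auto
  have content: "card {v\<in>V. \<chi> v = k} = card {j\<in>{1..?n}. \<Phi> \<chi> j = k}" for \<chi> k
    by (rule bij_betw_same_card[of \<sigma>], rule bij_betw_byWitness[of _ ?inv])
      (use \<sigma>V inv in \<open>auto simp: \<Phi>_def\<close>)
  have \<Psi>\<Phi>: "\<Psi> (\<Phi> \<chi>) = \<chi>" if "\<chi> \<in> pos_maps V" for \<chi>
    by (rule extensionalityI[of _ V]) (use that \<sigma>V in \<open>auto simp: \<Phi>_def \<Psi>_def pos_maps_def\<close>)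
  have \<Phi>\<Psi>: "\<Phi> (\<Psi> i) = i" if "i \<in> pos_maps {1..?n}" for i
    by (rule extensionalityI[of _ "{1..?n}"])
      (use that inv in \<open>auto simp: \<Phi>_def \<Psi>_def pos_maps_def\<close>)
  \<comment> \<open>An equivalence, so that it serves both inclusions: read forwards for
    \<open>\<Phi>\<close>, and backwards at \<open>\<Psi> i\<close> for
    \<open>\<Psi>\<close>.\<close>
  have in_Y: "\<Phi> \<chi> \<in> ?Y \<longleftrightarrow> \<chi> \<in> ?X" if \<chi>: "\<chi> \<in> pos_maps V" for \<chi>
  proof -
    have eq: "\<Phi> \<chi> j = \<chi> (?inv j)" "\<Phi> \<chi> (j + 1) = \<chi> (?inv (j + 1))"
      if "j \<in> {1..<?n}" for j
      using that by (auto simp: \<Phi>_def)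
    have "\<Phi> \<chi> \<in> pos_maps {1..?n}"
      using \<chi> inv(1) by (auto simp: pos_maps_def \<Phi>_def)
    moreover have "(\<forall>j\<in>{1..<?n}. \<Phi> \<chi> j \<le> \<Phi> \<chi> (j + 1)) \<longleftrightarrow>
        (\<forall>j\<in>{1..<?n}. \<chi> (?inv j) \<le> \<chi> (?inv (j + 1)))"
      by (rule ball_cong) (simp_all only: eq)
    moreover have "(\<forall>j\<in>S. \<Phi> \<chi> j < \<Phi> \<chi> (j + 1)) \<longleftrightarrow>
        (\<forall>j\<in>S. \<chi> (?inv j) < \<chi> (?inv (j + 1)))"
      using S by (intro ball_cong refl) (metis eq subsetD)
    ultimately show ?thesis
      using \<chi> by (simp only: content A_set_def mem_Collect_eq) blast
  qed
  have \<Psi>_pos: "\<Psi> i \<in> pos_maps V" if "i \<in> pos_maps {1..?n}" for i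
    using that \<sigma>V(1) by (auto simp: pos_maps_def \<Psi>_def)
  have XV: "?X \<subseteq> pos_maps V" by (auto simp: A_set_def)
  have YV: "?Y \<subseteq> pos_maps {1..?n}" by auto
  have "bij_betw \<Phi> ?X ?Y"
  proof (rule bij_betw_byWitness[of _ \<Psi>])
    show "\<forall>\<chi>\<in>?X. \<Psi> (\<Phi> \<chi>) = \<chi>" using \<Psi>\<Phi> XV by blast
    show "\<forall>i\<in>?Y. \<Phi> (\<Psi> i) = i" using \<Phi>\<Psi> YV by blast
    show "\<Phi> ` ?X \<subseteq> ?Y" using in_Y XV by blast
    show "\<Psi> ` ?Y \<subseteq> ?X"
    proof (rule image_subsetI)
      fix i assume i: "i \<in> ?Y"
      then have "i \<in> pos_maps {1..?n}" by blast
      then have "\<Phi> (\<Psi> i) = i" "\<Psi> i \<in> pos_maps V" by (rule \<Phi>\<Psi>, rule \<Psi>_pos)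
      then show "\<Psi> i \<in> ?X" using i in_Y[of "\<Psi> i"] by (simp only:)
    qed
  qed
  then show ?thesis unfolding F_coeff_def by (rule bij_betw_same_card)
qed

lemma F_expandable_A_set:
  assumes "\<sigma> \<in> bijs V" "S \<subseteq> {1..<card V}"
  shows "F_expandable V (A_set V \<sigma> S)"
proof -
  have "(\<Sum>S'\<in>Pow {1..<card V}. (if S' = S then 1 else 0) * F_coeff (card V) S' \<alpha>)
      = F_coeff (card V) S \<alpha>" for \<alpha>
    using assms(2) by (simp add: if_distrib[of "\<lambda>x. x * _"] sum.delta cong: if_cong)
  then show ?thesis
    unfolding F_expandable_def card_A_set_content[OF assms]
    by (intro exI[of _ "\<lambda>S'. if S' = S then 1 else 0"] allI) (rule sym)
qed

lemma finite_bijs: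
  assumes "finite e"
  shows "finite (bijs e)"
proof (rule finite_subset)
  show "bijs e \<subseteq> PiE e (\<lambda>_. {1..card e})"
    by (auto simp: bijs_def PiE_def bij_betw_def)
  show "finite (PiE e (\<lambda>_. {1..card e}))" using assms by (simp add: finite_PiE)
qed

text \<open>The fundamental lemma on \<open>(P, \<omega>)\<close>-partitions, for an arbitrary relation \<open>D\<close> in place
  of the partial order \<open>P\<close>: breaking ties of \<open>\<chi>\<close> by \<open>\<omega>\<close> sorts \<open>V\<close> in exactly one way.\<close>

lemma F_expandable_P_partitions:
  fixes \<omega> :: "'a \<Rightarrow> nat"
  assumes fin: "finite V" and \<omega>: "inj_on \<omega> V" and D: "D \<subseteq> V \<times> V"
  shows "F_expandable V {\<chi> \<in> pos_maps V.
    \<forall>(a, b)\<in>D. \<chi> a < \<chi> b \<or> \<chi> a = \<chi> b \<and> \<omega> a < \<omega> b}"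
proof -
  let ?n = "card V"
  \<comment> \<open>With \<open>N\<close> above every label, \<open>key\<close> encodes the
    lexicographic order on pairs (color, label) in one natural number.\<close>
  obtain N where N: "\<And>v. v \<in> V \<Longrightarrow> \<omega> v < N"
    using finite_nat_set_iff_bounded[of "\<omega> ` V"] fin by auto
  define key where "key = (\<lambda>\<chi> v. \<chi> v * N + \<omega> v)"
  have key_less: "key \<chi> u < key \<chi> v \<longleftrightarrow> \<chi> u < \<chi> v \<or> \<chi> u = \<chi> v \<and> \<omega> u < \<omega> v"
    if "u \<in> V" "v \<in> V" for \<chi> u v
  proof -
    have less: "key \<chi> x < key \<chi> y" if "\<chi> x < \<chi> y" "x \<in> V" for x y
    proof -
      have "key \<chi> x < Suc (\<chi> x) * N" using N[OF that(2)] by (simp add: key_def)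
      also have "\<dots> \<le> \<chi> y * N" using that(1) by (intro mult_right_mono) auto
      finally show ?thesis by (simp add: key_def)
    qed
    show ?thesis
    proof (cases "\<chi> u" "\<chi> v" rule: linorder_cases)
      case equal
      then show ?thesis by (simp add: key_def)
    qed (use less[of u v] less[of v u] that in auto)
  qed
  have key_inj: "inj_on (key \<chi>) V" for \<chi>
  proof (rule inj_onI)
    fix u v assume uv: "u \<in> V" "v \<in> V" "key \<chi> u = key \<chi> v"
    then have "\<chi> u = \<chi> v" using key_less[of u v \<chi>] key_less[of v u \<chi>] by force
    then show "u = v" using uv \<omega> by (simp add: key_def inj_onD)
  qed
  \<comment> \<open>The descents of the word of labels listed by \<sigma>. At a descent equal colors
    would be sorted the other way, so the colors must increase strictly; at an ascent a tie is
    allowed.\<close>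
  define Des where "Des = (\<lambda>\<sigma>. {i \<in> {1..<?n}.
    \<omega> (inv_into V \<sigma> (i + 1)) < \<omega> (inv_into V \<sigma> i)})"
  \<comment> \<open>Thus \<open>A_set V \<sigma> (Des \<sigma>)\<close> consists of the colorings
    whose key sorts \<open>V\<close> in the order \<sigma>.\<close>
  have A_iff: "\<chi> \<in> A_set V \<sigma> (Des \<sigma>) \<longleftrightarrow>
      \<chi> \<in> pos_maps V \<and> (\<forall>u\<in>V. \<forall>v\<in>V. \<sigma> u < \<sigma> v \<longleftrightarrow> key \<chi> u < key \<chi> v)"
    if \<sigma>: "\<sigma> \<in> bijs V" for \<chi> \<sigma>
  proof -
    have step: "key \<chi> (inv_into V \<sigma> i) < key \<chi> (inv_into V \<sigma> (i + 1)) \<longleftrightarrow>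
        \<chi> (inv_into V \<sigma> i) \<le> \<chi> (inv_into V \<sigma> (i + 1)) \<and>
        (i \<in> Des \<sigma> \<longrightarrow> \<chi> (inv_into V \<sigma> i) < \<chi> (inv_into V \<sigma> (i + 1)))"
      if i: "i \<in> {1..<?n}" for i
    proof -
      let ?a = "inv_into V \<sigma> i" and ?b = "inv_into V \<sigma> (i + 1)"
      have ab: "?a \<in> V" "?b \<in> V" "\<sigma> ?a = i" "\<sigma> ?b = i + 1"
        using bijs_inv_into[OF \<sigma>] i by auto
      then have "?a \<noteq> ?b" by force
      then have "\<omega> ?a \<noteq> \<omega> ?b" using \<omega> ab(1,2) by (meson inj_onD)
      moreover have "i \<in> Des \<sigma> \<longleftrightarrow> \<omega> ?b < \<omega> ?a" using i by (simp add: Des_def)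
      ultimately show ?thesis using key_less[OF ab(1,2), of \<chi>] by linarith
    qed
    have "Des \<sigma> \<subseteq> {1..<?n}" by (auto simp: Des_def)
    then show ?thesis
      unfolding bijs_mono_iff_consecutive[OF \<sigma>] A_set_def using step by blast
  qed
  \<comment> \<open>The linear extensions of \<open>D\<close>, as bijections. If \<open>D\<close>
    has a directed cycle there are none, and the set of colorings is empty too.\<close>
  define L where "L = {\<sigma> \<in> bijs V. \<forall>(a, b)\<in>D. \<sigma> a < \<sigma> b}"
  have "{\<chi> \<in> pos_maps V. \<forall>(a, b)\<in>D. \<chi> a < \<chi> b \<or> \<chi> a = \<chi> b \<and> \<omega> a < \<omega> b} =
      {\<chi> \<in> pos_maps V. \<forall>(a, b)\<in>D. key \<chi> a < key \<chi> b}"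
    using key_less D by blast
  also have "\<dots> = (\<Union>\<sigma>\<in>L. A_set V \<sigma> (Des \<sigma>))"
  proof (intro set_eqI iffI)
    fix \<chi> assume \<chi>: "\<chi> \<in> {\<chi> \<in> pos_maps V. \<forall>(a, b)\<in>D. key \<chi> a < key \<chi> b}"
    obtain \<sigma> where \<sigma>: "\<sigma> \<in> bijs V" "\<forall>u\<in>V. \<forall>v\<in>V. \<sigma> u < \<sigma> v \<longleftrightarrow> key \<chi> u < key \<chi> v"
      using ex_sorting_bij[OF fin key_inj] by blast
    then have "\<sigma> \<in> L" using \<chi> D unfolding L_def by blast
    moreover have "\<chi> \<in> A_set V \<sigma> (Des \<sigma>)" using A_iff \<sigma> \<chi> by blast
    ultimately show "\<chi> \<in> (\<Union>\<sigma>\<in>L. A_set V \<sigma> (Des \<sigma>))" by blast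
  next
    fix \<chi> assume "\<chi> \<in> (\<Union>\<sigma>\<in>L. A_set V \<sigma> (Des \<sigma>))"
    then show "\<chi> \<in> {\<chi> \<in> pos_maps V. \<forall>(a, b)\<in>D. key \<chi> a < key \<chi> b}"
      using A_iff D by (fastforce simp: L_def)
  qed
  finally have eq: "{\<chi> \<in> pos_maps V. \<forall>(a, b)\<in>D. \<chi> a < \<chi> b \<or> \<chi> a = \<chi> b \<and> \<omega> a < \<omega> b} =
      (\<Union>\<sigma>\<in>L. A_set V \<sigma> (Des \<sigma>))" .
  show ?thesis unfolding eq
  proof (rule F_expandable_disjoint_UN[OF fin])
    show "finite L" using finite_bijs[OF fin] by (simp add: L_def)
  next
    fix \<sigma> assume "\<sigma> \<in> L"
    then show "F_expandable V (A_set V \<sigma> (Des \<sigma>))"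
      by (intro F_expandable_A_set) (auto simp: L_def Des_def)
  next
    fix \<sigma> \<tau> assume st: "\<sigma> \<in> L" "\<tau> \<in> L" "\<sigma> \<noteq> \<tau>"
    show "A_set V \<sigma> (Des \<sigma>) \<inter> A_set V \<tau> (Des \<tau>) = {}"
    proof (rule ccontr)
      assume "\<not> ?thesis"
      then obtain \<chi> where "\<chi> \<in> A_set V \<sigma> (Des \<sigma>)" "\<chi> \<in> A_set V \<tau> (Des \<tau>)" by blast
      \<comment> \<open>Both orders agree with that of \<open>key \<chi>\<close>.\<close>
      then have "\<sigma> u < \<sigma> v \<longleftrightarrow> \<tau> u < \<tau> v" if "u \<in> V" "v \<in> V" for u v
        using A_iff that st by (auto simp: L_def)
      then have "\<sigma> = \<tau>"
        using st by (intro bijs_eqI[OF fin]) (auto simp: L_def linorder_not_less[symmetric])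
      then show False using st by blast
    qed
  qed (auto simp: A_set_def)
qed

section \<open>Combining the edges\<close>

text \<open>With a labelling whose descents along each edge are the strict steps, the conditions on
  all edges become one system of \<open>(P, \<omega>)\<close>-partition inequalities.\<close>

lemma F_expandable_edgewise_A_set:
  assumes hg: "hypergraph V E" and no_cycle: "\<nexists>vs es. is_cycle E vs es"
    and p: "\<And>e. e \<in> E \<Longrightarrow> p e \<in> bijs e"
    and T: "\<And>e. e \<in> E \<Longrightarrow> T e \<subseteq> {1..<card e}"
  shows "F_expandable V {\<chi> \<in> pos_maps V. \<forall>e\<in>E. restrict \<chi> e \<in> A_set e (p e) (T e)}"
proof -
  have fin: "finite V" and eV: "\<And>e. e \<in> E \<Longrightarrow> e \<subseteq> V"
    using hg by (auto simp: hypergraph_def)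
  obtain \<omega> :: "'a \<Rightarrow> nat" where \<omega>: "inj_on \<omega> V"
    and lab: "\<And>e i. e \<in> E \<Longrightarrow> i \<in> {1..<card e} \<Longrightarrow>
      if i \<in> T e then \<omega> (inv_into e (p e) (i + 1)) < \<omega> (inv_into e (p e) i)
      else \<omega> (inv_into e (p e) i) < \<omega> (inv_into e (p e) (i + 1))"
    using ex_labelling_with_descents[of V E p T, OF hg no_cycle p] by metis
  \<comment> \<open>Only consecutive pairs are collected: they already express the chain conditions,
    and \<open>F_expandable_P_partitions\<close> accepts any relation on \<open>V\<close>.\<close>
  define D where
    "D = (\<Union>e\<in>E. (\<lambda>i. (inv_into e (p e) i, inv_into e (p e) (i + 1))) ` {1..<card e})"
  have "restrict \<chi> e \<in> A_set e (p e) (T e) \<longleftrightarrow> (\<forall>i\<in>{1..<card e}.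
      \<chi> (inv_into e (p e) i) < \<chi> (inv_into e (p e) (i + 1)) \<or>
      \<chi> (inv_into e (p e) i) = \<chi> (inv_into e (p e) (i + 1)) \<and>
      \<omega> (inv_into e (p e) i) < \<omega> (inv_into e (p e) (i + 1)))"
    if \<chi>: "\<chi> \<in> pos_maps V" and e: "e \<in> E" for \<chi> e
  proof -
    let ?inv = "inv_into e (p e)"
    have mem: "?inv i \<in> e" "?inv (i + 1) \<in> e" if "i \<in> {1..<card e}" for i
      using bijs_inv_into(1)[OF p[OF e]] that by auto
    have "restrict \<chi> e \<in> pos_maps e" using \<chi> eV[OF e] by (auto simp: pos_maps_def)
    moreover have "(\<forall>i\<in>{1..<card e}. restrict \<chi> e (?inv i) \<le> restrict \<chi> e (?inv (i + 1)))
        \<longleftrightarrow> (\<forall>i\<in>{1..<card e}. \<chi> (?inv i) \<le> \<chi> (?inv (i + 1)))"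
      by (rule ball_cong) (simp_all only: restrict_apply' mem)
    moreover have "(\<forall>i\<in>T e. restrict \<chi> e (?inv i) < restrict \<chi> e (?inv (i + 1)))
        \<longleftrightarrow> (\<forall>i\<in>T e. \<chi> (?inv i) < \<chi> (?inv (i + 1)))"
      using T[OF e] mem by (intro ball_cong refl) (metis restrict_apply' subsetD)
    ultimately have "restrict \<chi> e \<in> A_set e (p e) (T e) \<longleftrightarrow> (\<forall>i\<in>{1..<card e}.
        \<chi> (?inv i) \<le> \<chi> (?inv (i + 1)) \<and> (i \<in> T e \<longrightarrow> \<chi> (?inv i) < \<chi> (?inv (i + 1))))"
      unfolding A_set_def using T[OF e] by blast
    \<comment> \<open>At \<open>i \<in> T e\<close> the labels descend, which rules out the tie and
      leaves the strict inequality; elsewhere they ascend, which admits the tie and gives the weak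
      one.\<close>
    also have "\<dots> \<longleftrightarrow> (\<forall>i\<in>{1..<card e}. \<chi> (?inv i) < \<chi> (?inv (i + 1)) \<or>
        \<chi> (?inv i) = \<chi> (?inv (i + 1)) \<and> \<omega> (?inv i) < \<omega> (?inv (i + 1)))"
    proof (rule ball_cong)
      fix i assume "i \<in> {1..<card e}"
      then show "(\<chi> (?inv i) \<le> \<chi> (?inv (i + 1)) \<and>
            (i \<in> T e \<longrightarrow> \<chi> (?inv i) < \<chi> (?inv (i + 1)))) \<longleftrightarrow>
          (\<chi> (?inv i) < \<chi> (?inv (i + 1)) \<or>
            \<chi> (?inv i) = \<chi> (?inv (i + 1)) \<and> \<omega> (?inv i) < \<omega> (?inv (i + 1)))"
        using lab[OF e] by (cases "i \<in> T e") force+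
    qed simp
    finally show ?thesis .
  qed
  then have "{\<chi> \<in> pos_maps V. \<forall>e\<in>E. restrict \<chi> e \<in> A_set e (p e) (T e)} =
      {\<chi> \<in> pos_maps V. \<forall>(a, b)\<in>D. \<chi> a < \<chi> b \<or> \<chi> a = \<chi> b \<and> \<omega> a < \<omega> b}"
    unfolding D_def by auto
  moreover have "D \<subseteq> V \<times> V"
    unfolding D_def using bijs_inv_into(1)[OF p] eV by fastforce
  ultimately show ?thesis using F_expandable_P_partitions[OF fin \<omega>] by simp
qed

theorem theorem5p1:
  fixes V :: "'a set" and E :: "'a set set"
  assumes "hypertree V E"
    and "\<forall>e\<in>E. \<exists>Sel :: ('a \<Rightarrow> nat) \<Rightarrow> nat set.
           (\<forall>\<pi>\<in>bijs e. Sel \<pi> \<subseteq> {1..<card e}) \<and>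
           nonconst_colorings e = (\<Union>\<pi>\<in>bijs e. A_set e \<pi> (Sel \<pi>)) \<and>
           (\<forall>\<pi>\<in>bijs e. \<forall>\<pi>'\<in>bijs e. \<pi> \<noteq> \<pi>' \<longrightarrow>
              A_set e \<pi> (Sel \<pi>) \<inter> A_set e \<pi>' (Sel \<pi>') = {})"
  shows "F_positive V E"
proof -
  obtain Sel :: "'a set \<Rightarrow> ('a \<Rightarrow> nat) \<Rightarrow> nat set" where
    Sel: "\<And>e \<pi>. e \<in> E \<Longrightarrow> \<pi> \<in> bijs e \<Longrightarrow> Sel e \<pi> \<subseteq> {1..<card e}"
    and cover: "\<And>e. e \<in> E \<Longrightarrow> nonconst_colorings e = (\<Union>\<pi>\<in>bijs e. A_set e \<pi> (Sel e \<pi>))"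
    and disj: "\<And>e \<pi> \<pi>'. e \<in> E \<Longrightarrow> \<pi> \<in> bijs e \<Longrightarrow> \<pi>' \<in> bijs e \<Longrightarrow> \<pi> \<noteq> \<pi>' \<Longrightarrow>
              A_set e \<pi> (Sel e \<pi>) \<inter> A_set e \<pi>' (Sel e \<pi>') = {}"
  proof -
    obtain Sel where "\<forall>e\<in>E. (\<forall>\<pi>\<in>bijs e. Sel e \<pi> \<subseteq> {1..<card e}) \<and>
        nonconst_colorings e = (\<Union>\<pi>\<in>bijs e. A_set e \<pi> (Sel e \<pi>)) \<and>
        (\<forall>\<pi>\<in>bijs e. \<forall>\<pi>'\<in>bijs e. \<pi> \<noteq> \<pi>' \<longrightarrow>
           A_set e \<pi> (Sel e \<pi>) \<inter> A_set e \<pi>' (Sel e \<pi>') = {})"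
      using bchoice[OF assms(2)] by (elim exE)
    then show thesis by (intro that[of Sel]) simp_all
  qed
  have hg: "hypergraph V E" and no_cycle: "\<nexists>vs es. is_cycle E vs es"
    using assms(1) by (auto simp: hypertree_def)
  have fin: "finite V" and eV: "\<And>e. e \<in> E \<Longrightarrow> e \<subseteq> V"
    using hg by (auto simp: hypergraph_def)
  have finE: "finite E" using fin eV by (meson Pow_iff finite_Pow_iff finite_subset subsetI)
  \<comment> \<open>The class of colorings for which \<open>p\<close> names, on every edge, the
    piece of the given disjoint union that contains the restricted coloring.\<close>
  define C where "C = (\<lambda>p. {\<chi> \<in> pos_maps V.
    \<forall>e\<in>E. restrict \<chi> e \<in> A_set e (p e) (Sel e (p e))})"
  have proper_iff: "proper E \<chi> \<longleftrightarrow>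
      (\<forall>e\<in>E. \<exists>\<pi>\<in>bijs e. restrict \<chi> e \<in> A_set e \<pi> (Sel e \<pi>))"
    if "\<chi> \<in> pos_maps V" for \<chi>
  proof -
    have "restrict \<chi> e \<in> nonconst_colorings e \<longleftrightarrow> (\<exists>u\<in>e. \<exists>v\<in>e. \<chi> u \<noteq> \<chi> v)"
      if "e \<in> E" for e
      using \<open>\<chi> \<in> pos_maps V\<close> eV[OF that] by (auto simp: nonconst_colorings_def pos_maps_def)
    then show ?thesis using cover by (simp add: proper_def)
  qed
  have proper_eq: "{\<chi> \<in> pos_maps V. proper E \<chi>} = (\<Union>p\<in>PiE E bijs. C p)"
  proof (intro set_eqI iffI)
    fix \<chi> assume "\<chi> \<in> {\<chi> \<in> pos_maps V. proper E \<chi>}"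
    then have \<chi>: "\<chi> \<in> pos_maps V"
      and ex: "\<forall>e\<in>E. \<exists>\<pi>. \<pi> \<in> bijs e \<and> restrict \<chi> e \<in> A_set e \<pi> (Sel e \<pi>)"
      using proper_iff by blast+
    obtain p where p: "\<forall>e\<in>E. p e \<in> bijs e \<and> restrict \<chi> e \<in> A_set e (p e) (Sel e (p e))"
      using bchoice[OF ex] by blast
    \<comment> \<open>Restricting \<open>p\<close> to \<open>E\<close> puts it into the finite index
      set \<open>PiE E bijs\<close>.\<close>
    then have "restrict p E \<in> PiE E bijs" "\<chi> \<in> C (restrict p E)"
      using \<chi> by (auto simp: C_def)
    then show "\<chi> \<in> (\<Union>p\<in>PiE E bijs. C p)" by blast
  next
    fix \<chi> assume "\<chi> \<in> (\<Union>p\<in>PiE E bijs. C p)"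
    then obtain p where p: "p \<in> PiE E bijs" "\<chi> \<in> pos_maps V"
        "\<And>e. e \<in> E \<Longrightarrow> restrict \<chi> e \<in> A_set e (p e) (Sel e (p e))"
      by (auto simp: C_def)
    then show "\<chi> \<in> {\<chi> \<in> pos_maps V. proper E \<chi>}"
      using proper_iff PiE_mem[OF p(1)] by blast
  qed
  have "F_expandable V (\<Union>p\<in>PiE E bijs. C p)"
  proof (rule F_expandable_disjoint_UN[OF fin])
    show "finite (PiE E bijs)"
      using finE fin eV by (intro finite_PiE finite_bijs) (auto intro: finite_subset)
  next
    fix p assume "p \<in> PiE E bijs"
    then show "F_expandable V (C p)"
      unfolding C_def using Sel by (intro F_expandable_edgewise_A_set hg no_cycle) (auto dest!: PiE_mem)
  next
    fix p q assume pq: "p \<in> PiE E bijs" "q \<in> PiE E bijs" "p \<noteq> q"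
    \<comment> \<open>Extensional choices that differ do so at some edge, and there the pieces are
      disjoint.\<close>
    then obtain e where e: "e \<in> E" "p e \<noteq> q e" by (meson PiE_ext)
    then have "A_set e (p e) (Sel e (p e)) \<inter> A_set e (q e) (Sel e (q e)) = {}"
      using disj pq PiE_mem by metis
    then show "C p \<inter> C q = {}" using e(1) by (auto simp: C_def)
  qed (auto simp: C_def)
  then obtain c :: "nat set \<Rightarrow> nat" where c: "\<And>\<alpha>.
      card {\<chi> \<in> {\<chi> \<in> pos_maps V. proper E \<chi>}. (\<lambda>i. card {v\<in>V. \<chi> v = i}) = \<alpha>} =
        (\<Sum>S\<in>Pow {1..<card V}. c S * F_coeff (card V) S \<alpha>)"
    unfolding F_expandable_def proper_eq by blast
  have "int (XH_coeff V E \<alpha>) =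
      (\<Sum>S\<in>Pow {1..<card V}. int (c S) * int (F_coeff (card V) S \<alpha>))" for \<alpha>
    using c[of \<alpha>] by (simp add: XH_coeff_def conj_assoc)
  then show ?thesis
    unfolding F_positive_def by (intro exI[of _ "\<lambda>S. int (c S)"]) auto
qed

end
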